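(* Let $0<\alpha<1$ and let $p_\alpha(x)=\frac{1-\alpha}{2\pi^{1-\alpha}}\cdot\frac{1}{|x|^\alpha}\cdot\mathbf{1}_{[-\pi,\pi]}(x)$. Let ${\bf V}$ be the $N\times N$ random Vandermonde matrix with phases i.i.d. with density $p_\alpha$, and let $\lambda_N$ be the maximum eigenvalue of ${\bf V}^*{\bf V}$. Then $$\mathbb{P}\Big(\lambda_N\ge\frac12\cdot\frac{N^\alpha}{2^{1-\alpha}}\Big)=1-o(1)\quad\text{as }N\to\infty.$$
   Context: ${\bf V}=N^{-1/2}(e^{-j(k-1)\theta_l})_{1\le k,l\le N}$ with $\theta_1,\dots,\theta_N$ i.i.d. with density $p_\alpha$. *)

theory Defs
  imports "HOL-Probability.Probability" "Jordan_Normal_Form.Schur_Decomposition"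
begin

definition p_dens :: "real \<Rightarrow> real \<Rightarrow> real" where
  "p_dens \<alpha> x = (1 - \<alpha>) / (2 * pi powr (1 - \<alpha>)) * (1 / \<bar>x\<bar> powr \<alpha>)
                  * indicator {-pi..pi} x"

definition phase_dist :: "real \<Rightarrow> real measure" where
  "phase_dist \<alpha> = density lborel (\<lambda>x. ennreal (p_dens \<alpha> x))"

definition phases_law :: "real \<Rightarrow> nat \<Rightarrow> (nat \<Rightarrow> real) measure" where
  "phases_law \<alpha> N = PiM {..<N} (\<lambda>_. phase_dist \<alpha>)"

(* V = N^{-1/2} (exp(-i (k-1) theta_l))_{1<=k,l<=N}, indices shifted to 0..N-1 *)
definition vandermonde :: "nat \<Rightarrow> (nat \<Rightarrow> real) \<Rightarrow> complex mat" where
  "vandermonde N \<theta> = mat N N (\<lambda>(k, l).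
      complex_of_real (1 / sqrt (real N)) * exp (- \<i> * of_nat k * complex_of_real (\<theta> l)))"

definition VstarV :: "nat \<Rightarrow> (nat \<Rightarrow> real) \<Rightarrow> complex mat" where
  "VstarV N \<theta> = mat_adjoint (vandermonde N \<theta>) * vandermonde N \<theta>"

(* maximum eigenvalue of a Hermitian matrix (all eigenvalues are real) *)
definition max_eigenvalue :: "complex mat \<Rightarrow> real" where
  "max_eigenvalue A = Max {x :: real. eigenvalue A (complex_of_real x)}"

end

theory Submission
  imports Defs "Jordan_Normal_Form.Spectral_Radius" "HOL-Real_Asymp.Real_Asymp"
begin

text \<open>
  Let K be the number of phases with |\<theta>| \<le> \<pi> / (2N). Each phase lies in this window with probability
  (1 / (2N))^(1 - \<alpha>), so K has mean m = N^\<alpha> / 2^(1 - \<alpha>), and a Chernoff bound gives K > 3m/4 except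
  with probability exp (- m / 80). The vector with entries exp (i (N - 1) \<theta>_l / 2) on the indices of
  these phases, and 0 elsewhere, has Rayleigh quotient at least (1 - \<pi>^2 / 48) K \<ge> 2K/3, so the largest
  eigenvalue is at least m/2 when K > 3m/4. Since the largest eigenvalue of a Hermitian matrix is the
  maximum of the Rayleigh quotient, its strict superlevel sets are unions of open sets of phases,
  which makes the event measurable.
\<close>

section \<open>The Rayleigh principle for Hermitian matrices\<close>

text \<open>Coefficients and vectors are functions on indices, so that compactness and continuity
  come from the product topology. For Hermitian \<open>b\<close> the sum is already real and
  \<open>Re\<close> only changes its type.\<close>

definition quad_form :: "nat \<Rightarrow> (nat \<Rightarrow> nat \<Rightarrow> complex) \<Rightarrow> (nat \<Rightarrow> complex) \<Rightarrow> real" where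
  "quad_form n b x = Re (\<Sum>i<n. \<Sum>j<n. cnj (x i) * b i j * x j)"

lemma quad_form_scale:
  "quad_form n b (\<lambda>i. complex_of_real t * x i) = t\<^sup>2 * quad_form n b x"
proof -
  have "(\<Sum>i<n. \<Sum>j<n. cnj (complex_of_real t * x i) * b i j * (complex_of_real t * x j))
      = complex_of_real (t\<^sup>2) * (\<Sum>i<n. \<Sum>j<n. cnj (x i) * b i j * x j)"
    by (simp add: sum_distrib_left power2_eq_square mult_ac)
  then show ?thesis
    unfolding quad_form_def by (simp del: of_real_power)
qed

lemma cnj_mult_self: "cnj z * z = complex_of_real ((cmod z)\<^sup>2)"
  using complex_norm_square[of z] by (metis mult.commute)

lemma cnj_mult_of_real_mult_self:
  "cnj z * (complex_of_real e * z) = complex_of_real (e * (cmod z)\<^sup>2)"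
  by (simp only: of_real_mult cnj_mult_self[symmetric] mult.left_commute)

lemma quad_form_eigenvector:
  assumes "\<And>i. i < n \<Longrightarrow> (\<Sum>j<n. b i j * x j) = complex_of_real e * x i"
  shows "quad_form n b x = e * (\<Sum>i<n. (cmod (x i))\<^sup>2)"
proof -
  have "(\<Sum>i<n. \<Sum>j<n. cnj (x i) * b i j * x j) = (\<Sum>i<n. cnj (x i) * (\<Sum>j<n. b i j * x j))"
    by (simp add: sum_distrib_left mult_ac)
  also have "\<dots> = (\<Sum>i<n. complex_of_real (e * (cmod (x i))\<^sup>2))"
    by (intro sum.cong refl) (simp only: assms lessThan_iff cnj_mult_of_real_mult_self)
  finally show ?thesis
    unfolding quad_form_def by (simp add: sum_distrib_left del: of_real_power of_real_mult)
qed

text \<open>With y = B x, the inequality 0 \<le> q(x - t y) = - 2 t |y|^2 + t^2 q(y) for small t > 0 forces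
  y = 0.\<close>

lemma quad_form_zero_imp_kernel:
  assumes herm: "\<And>i j. i < n \<Longrightarrow> j < n \<Longrightarrow> b j i = cnj (b i j)"
    and nonneg: "\<And>y. 0 \<le> quad_form n b y"
    and zero: "quad_form n b x = 0"
    and i: "i < n"
  shows "(\<Sum>j<n. b i j * x j) = 0"
proof -
  define y where "y i = (\<Sum>j<n. b i j * x j)" for i
  define S where "S = (\<Sum>i<n. (cmod (y i))\<^sup>2)"
  have cross1: "(\<Sum>i<n. \<Sum>j<n. cnj (y i) * b i j * x j) = complex_of_real S"
  proof -
    have "(\<Sum>i<n. \<Sum>j<n. cnj (y i) * b i j * x j) = (\<Sum>i<n. cnj (y i) * (\<Sum>j<n. b i j * x j))"
      by (simp add: sum_distrib_left mult_ac)
    also have "\<dots> = (\<Sum>i<n. cnj (y i) * y i)" by (simp only: y_def)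
    also have "\<dots> = complex_of_real S"
      unfolding S_def of_real_sum
      by (intro sum.cong refl cnj_mult_self)
    finally show ?thesis .
  qed
  \<comment> \<open>Hermitian symmetry makes this the conjugate of the first cross term, which is
    real.\<close>
  have cross2: "(\<Sum>i<n. \<Sum>j<n. cnj (x i) * b i j * y j) = complex_of_real S"
  proof -
    have "(\<Sum>i<n. \<Sum>j<n. cnj (x i) * b i j * y j) = cnj (\<Sum>i<n. \<Sum>j<n. cnj (y j) * b j i * x i)"
      unfolding cnj_sum by (intro sum.cong refl) (simp add: herm[symmetric] mult_ac)
    also have "(\<Sum>i<n. \<Sum>j<n. cnj (y j) * b j i * x i) = complex_of_real S"
      using cross1 by (subst sum.swap) simp
    finally show ?thesis by simp
  qed
  have expand: "quad_form n b (\<lambda>i. x i - complex_of_real t * y i)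
      = - 2 * t * S + t\<^sup>2 * quad_form n b y" for t
  proof -
    let ?t = "complex_of_real t"
    have "(\<Sum>i<n. \<Sum>j<n. cnj (x i - ?t * y i) * b i j * (x j - ?t * y j))
        = (\<Sum>i<n. \<Sum>j<n. cnj (x i) * b i j * x j - ?t * (cnj (y i) * b i j * x j)
             - ?t * (cnj (x i) * b i j * y j) + cnj (?t * y i) * b i j * (?t * y j))"
      by (intro sum.cong refl) (simp add: algebra_simps)
    also have "\<dots> = (\<Sum>i<n. \<Sum>j<n. cnj (x i) * b i j * x j)
          - ?t * (\<Sum>i<n. \<Sum>j<n. cnj (y i) * b i j * x j)
          - ?t * (\<Sum>i<n. \<Sum>j<n. cnj (x i) * b i j * y j)
          + (\<Sum>i<n. \<Sum>j<n. cnj (?t * y i) * b i j * (?t * y j))"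
      by (simp only: sum.distrib sum_subtractf sum_distrib_left)
    finally have "quad_form n b (\<lambda>i. x i - ?t * y i)
        = quad_form n b x - t * S - t * S + quad_form n b (\<lambda>i. ?t * y i)"
      unfolding quad_form_def cross1 cross2 by simp
    then show ?thesis
      using zero by (simp add: quad_form_scale)
  qed
  let ?q = "quad_form n b y"
  have "S \<ge> 0" unfolding S_def by (intro sum_nonneg) simp
  have "S = 0"
  proof (rule ccontr)
    assume "S \<noteq> 0"
    with \<open>S \<ge> 0\<close> have S: "S > 0" by simp
    \<comment> \<open>Any t > 0 with t q(y) < 2 S contradicts nonnegativity; adding 1 keeps the
      denominator positive when q(y) = 0.\<close>
    define t where "t = S / (?q + 1)"
    have q: "?q + 1 > 0" using nonneg[of y] by simp
    have t: "t > 0" unfolding t_def using S q by simp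
    have "0 \<le> - 2 * t * S + t\<^sup>2 * ?q" using nonneg expand by metis
    then have "0 \<le> t * (t * ?q - 2 * S)" by (simp add: power2_eq_square algebra_simps)
    then have "2 * S \<le> t * ?q" using t by (simp add: zero_le_mult_iff)
    also have "\<dots> \<le> t * (?q + 1)" using t by simp
    also have "\<dots> = S" unfolding t_def using q by simp
    finally show False using S by simp
  qed
  then have "(cmod (y i))\<^sup>2 = 0"
    unfolding S_def using i by (subst (asm) sum_nonneg_eq_0_iff) auto
  then show ?thesis unfolding y_def by simp
qed

text \<open>Forcing the coordinates from \<open>n\<close> on to be 0 places the sphere in a product
  of closed unit discs and singletons, which is compact by Tychonoff; the norm condition cuts out a
  closed subset.\<close>

lemma compact_unit_sphere_finite_coordinates:
  "compact {x :: nat \<Rightarrow> complex. (\<forall>i\<ge>n. x i = 0) \<and> (\<Sum>i<n. (cmod (x i))\<^sup>2) = 1}"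
    (is "compact ?S")
proof -
  define B :: "nat \<Rightarrow> complex set" where "B i = (if i < n then cball 0 1 else {0})" for i
  have "compactin (product_topology (\<lambda>i::nat. euclidean :: complex topology) UNIV) (PiE UNIV B)"
    unfolding compactin_PiE by (auto simp: B_def)
  then have B: "compact (PiE UNIV B)"
    by (simp add: euclidean_product_topology)
  have cont: "continuous_on UNIV (\<lambda>x::nat \<Rightarrow> complex. x i)" for i
    by simp
  have "closed {x :: nat \<Rightarrow> complex. (\<Sum>i<n. (cmod (x i))\<^sup>2) = 1}"
    by (intro closed_Collect_eq continuous_intros cont)
  then have "compact (PiE UNIV B \<inter> {x. (\<Sum>i<n. (cmod (x i))\<^sup>2) = 1})"
    by (intro compact_Int_closed B)
  also have "PiE UNIV B \<inter> {x. (\<Sum>i<n. (cmod (x i))\<^sup>2) = 1} = ?S"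
  proof -
    have "cmod (x i) \<le> 1" if "(\<Sum>i<n. (cmod (x i))\<^sup>2) = 1" "i < n" for x :: "nat \<Rightarrow> complex" and i
    proof -
      have "(cmod (x i))\<^sup>2 \<le> (\<Sum>i<n. (cmod (x i))\<^sup>2)"
        by (rule member_le_sum) (use that in auto)
      then show ?thesis using that by (simp add: power_le_one_iff abs_square_le_1)
    qed
    then show ?thesis
      by (auto simp: B_def PiE_iff not_less split: if_splits)
  qed
  finally show ?thesis .
qed

lemma continuous_on_quad_form [continuous_intros]:
  assumes "\<And>i j. i < n \<Longrightarrow> j < n \<Longrightarrow> continuous_on S (\<lambda>s. b s i j)"
    and "\<And>i. i < n \<Longrightarrow> continuous_on S (\<lambda>s. x s i)"
  shows "continuous_on S (\<lambda>s. quad_form n (b s) (x s))"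
  unfolding quad_form_def by (intro continuous_intros assms) auto

text \<open>The form attains a maximum e on the compact unit sphere, at some x. Then e I - b is
  Hermitian with a nonnegative form that vanishes at x, so x lies in its kernel.\<close>

lemma hermitian_top_eigenvector:
  assumes herm: "\<And>i j. i < n \<Longrightarrow> j < n \<Longrightarrow> b j i = cnj (b i j)" and n: "n > 0"
  obtains e x where
    "\<And>i. i < n \<Longrightarrow> (\<Sum>j<n. b i j * x j) = complex_of_real e * x i"
    "(\<Sum>i<n. (cmod (x i))\<^sup>2) = 1"
    "\<And>y. quad_form n b y \<le> e * (\<Sum>i<n. (cmod (y i))\<^sup>2)"
proof -
  define S where "S = {x :: nat \<Rightarrow> complex. (\<forall>i\<ge>n. x i = 0) \<and> (\<Sum>i<n. (cmod (x i))\<^sup>2) = 1}"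
  have "compact S" unfolding S_def by (rule compact_unit_sphere_finite_coordinates)
  moreover have "(\<lambda>i. if i = 0 then 1 else 0) \<in> S"
    unfolding S_def using n by (auto simp: if_distrib[of cmod] if_distrib[of "\<lambda>z. z\<^sup>2"] cong: if_cong)
  moreover have "continuous_on S (quad_form n b)"
    by (intro continuous_on_quad_form continuous_on_const)
       (rule continuous_on_subset[OF continuous_on_product_coordinates], simp)
  ultimately obtain x where x: "x \<in> S" and max: "\<And>y. y \<in> S \<Longrightarrow> quad_form n b y \<le> quad_form n b x"
    using continuous_attains_sup[of S "quad_form n b"] by blast
  define e where "e = quad_form n b x"
  have le: "quad_form n b y \<le> e * (\<Sum>i<n. (cmod (y i))\<^sup>2)" for y
  proof (cases "(\<Sum>i<n. (cmod (y i))\<^sup>2) = 0")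
    case True
    then have "y i = 0" if "i < n" for i
      using that by (subst (asm) sum_nonneg_eq_0_iff) auto
    then show ?thesis using True by (simp add: quad_form_def)
  next
    case False
    define r where "r = sqrt (\<Sum>i<n. (cmod (y i))\<^sup>2)"
    have r2: "r\<^sup>2 = (\<Sum>i<n. (cmod (y i))\<^sup>2)"
      unfolding r_def by (simp add: sum_nonneg)
    with False have r: "r \<noteq> 0" by auto
    \<comment> \<open>Normalizing alone does not reach \<open>S\<close>: the coordinates from
      \<open>n\<close> on must also be cut to 0, which leaves the form unchanged.\<close>
    define z where "z i = (if i < n then complex_of_real (1 / r) * y i else 0)" for i
    have "z \<in> S"
      unfolding S_def using r
      by (auto simp: z_def norm_divide power_divide r2[symmetric] sum_divide_distrib[symmetric])
    then have "quad_form n b z \<le> e" unfolding e_def by (rule max)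
    moreover have "quad_form n b z = quad_form n b (\<lambda>i. complex_of_real (1 / r) * y i)"
      unfolding quad_form_def z_def by simp
    ultimately have "(1 / r)\<^sup>2 * quad_form n b y \<le> e"
      by (simp only: quad_form_scale)
    then show ?thesis
      using r unfolding r2[symmetric] by (simp add: power_divide divide_le_eq)
  qed
  define c where "c i j = complex_of_real e * (if i = j then 1 else 0) - b i j" for i j
  have c_row: "(\<Sum>j<n. c i j * y j) = complex_of_real e * y i - (\<Sum>j<n. b i j * y j)"
    if "i < n" for i y
  proof -
    have "(\<Sum>j<n. c i j * y j) =
        (\<Sum>j<n. if i = j then complex_of_real e * y j else 0) - (\<Sum>j<n. b i j * y j)"
      unfolding sum_subtractf[symmetric] by (intro sum.cong refl) (auto simp: c_def algebra_simps)
    then show ?thesis using that by simp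
  qed
  have c_form: "quad_form n c y = e * (\<Sum>i<n. (cmod (y i))\<^sup>2) - quad_form n b y" for y
  proof -
    have "(\<Sum>i<n. \<Sum>j<n. cnj (y i) * c i j * y j) = (\<Sum>i<n. cnj (y i) * (\<Sum>j<n. c i j * y j))"
      by (simp add: sum_distrib_left mult_ac)
    also have "\<dots> = (\<Sum>i<n. complex_of_real (e * (cmod (y i))\<^sup>2) - cnj (y i) * (\<Sum>j<n. b i j * y j))"
      by (intro sum.cong refl) (simp only: c_row lessThan_iff right_diff_distrib cnj_mult_of_real_mult_self)
    also have "\<dots> = complex_of_real (e * (\<Sum>i<n. (cmod (y i))\<^sup>2)) - (\<Sum>i<n. \<Sum>j<n. cnj (y i) * b i j * y j)"
      by (simp add: sum_subtractf sum_distrib_left mult_ac)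
    finally show ?thesis unfolding quad_form_def by (simp del: of_real_mult)
  qed
  have norm_x: "(\<Sum>i<n. (cmod (x i))\<^sup>2) = 1" using x by (simp add: S_def)
  have "(\<Sum>j<n. c i j * x j) = 0" if "i < n" for i
  proof (rule quad_form_zero_imp_kernel)
    show "c j i = cnj (c i j)" if "i < n" "j < n" for i j
      using herm[OF that] by (simp add: c_def)
    show "0 \<le> quad_form n c y" for y using le by (simp add: c_form)
    show "quad_form n c x = 0" using norm_x by (simp add: c_form e_def)
  qed fact
  then have "(\<Sum>j<n. b i j * x j) = complex_of_real e * x i" if "i < n" for i
    using that by (simp add: c_row)
  with norm_x le show ?thesis by (rule that[rotated 1])
qed

lemma max_eigenvalue_hermitian:
  assumes A: "A \<in> carrier_mat n n" and n: "n > 0"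
    and herm: "\<And>i j. i < n \<Longrightarrow> j < n \<Longrightarrow> A $$ (j, i) = cnj (A $$ (i, j))"
  defines "b \<equiv> \<lambda>i j. A $$ (i, j)"
  shows quad_form_le_max_eigenvalue:
      "quad_form n b y \<le> max_eigenvalue A * (\<Sum>i<n. (cmod (y i))\<^sup>2)"
    and max_eigenvalue_attained:
      "\<exists>x. (\<Sum>i<n. (cmod (x i))\<^sup>2) = 1 \<and> quad_form n b x = max_eigenvalue A"
proof -
  obtain e x where x: "\<And>i. i < n \<Longrightarrow> (\<Sum>j<n. b i j * x j) = complex_of_real e * x i"
    "(\<Sum>i<n. (cmod (x i))\<^sup>2) = 1"
    and le: "\<And>y. quad_form n b y \<le> e * (\<Sum>i<n. (cmod (y i))\<^sup>2)"
    by (rule hermitian_top_eigenvector[of n b]) (auto simp only: b_def intro!: herm n)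
  let ?E = "{r :: real. eigenvalue A (complex_of_real r)}"
  have mult: "(A *\<^sub>v vec n z) $ i = (\<Sum>j<n. b i j * z j)" if "i < n" for z i
    using that A by (simp add: b_def scalar_prod_def lessThan_atLeast0)
  have "max_eigenvalue A = e"
    unfolding max_eigenvalue_def
  proof (rule Max_eqI)
    \<comment> \<open>\<open>Max\<close> is meaningful only on a finite set; the real eigenvalues
      embed injectively into the finite spectrum.\<close>
    have "finite (complex_of_real -` spectrum A)"
      by (intro finite_vimageI card_finite_spectrum[OF A]) (simp add: inj_on_def)
    then show "finite ?E" by (simp add: spectrum_def vimage_def)
  next
    fix r assume "r \<in> ?E"
    then obtain v where v: "v \<in> carrier_vec n" "v \<noteq> 0\<^sub>v n" "A *\<^sub>v v = complex_of_real r \<cdot>\<^sub>v v"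
      using A unfolding eigenvalue_def eigenvector_def by auto
    have v_vec: "vec n (($) v) = v" using v(1) by auto
    have row: "(\<Sum>j<n. b i j * v $ j) = complex_of_real r * v $ i" if "i < n" for i
      using mult[OF that, of "($) v"] v that unfolding v_vec by simp
    \<comment> \<open>At an eigenvector the form is the eigenvalue times the squared norm, so the
      Rayleigh bound compares r with e.\<close>
    have "r * (\<Sum>i<n. (cmod (v $ i))\<^sup>2) \<le> e * (\<Sum>i<n. (cmod (v $ i))\<^sup>2)"
      using le[of "($) v"] quad_form_eigenvector[of n b "($) v" r] row by simp
    moreover have "(\<Sum>i<n. (cmod (v $ i))\<^sup>2) > 0"
    proof -
      obtain i where "i < n" "v $ i \<noteq> 0"
        using v(1,2) by (metis eq_vecI carrier_vecD index_zero_vec)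
      then show ?thesis by (intro sum_pos2[of _ i]) auto
    qed
    ultimately show "r \<le> e" by simp
  next
    have "vec n x \<noteq> 0\<^sub>v n"
    proof
      assume 0: "vec n x = 0\<^sub>v n"
      have "x i = 0" if "i < n" for i
        using arg_cong[OF 0, of "\<lambda>v. v $ i"] that by simp
      with x(2) show False by simp
    qed
    moreover have "A *\<^sub>v vec n x = complex_of_real e \<cdot>\<^sub>v vec n x"
      using A x(1) mult by (intro eq_vecI) (auto simp del: index_mult_mat_vec)
    ultimately show "e \<in> ?E"
      using A by (auto simp: eigenvalue_def eigenvector_def intro!: exI[of _ "vec n x"])
  qed
  with le x(2) quad_form_eigenvector[of n b x e, OF x(1)]
  show "quad_form n b y \<le> max_eigenvalue A * (\<Sum>i<n. (cmod (y i))\<^sup>2)"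
    and "\<exists>x. (\<Sum>i<n. (cmod (x i))\<^sup>2) = 1 \<and> quad_form n b x = max_eigenvalue A"
    by auto
qed

section \<open>The phase distribution\<close>

lemma has_integral_abs_powr_symmetric:
  assumes "a > (-1::real)" "c \<ge> 0"
  shows "((\<lambda>x. \<bar>x\<bar> powr a) has_integral (2 * (c powr (a + 1) / (a + 1)))) {-c..c}"
proof -
  have right: "((\<lambda>x. \<bar>x\<bar> powr a) has_integral (c powr (a + 1) / (a + 1))) {0..c}"
    by (rule has_integral_eq[OF _ has_integral_powr_from_0[OF assms]]) simp
  have left: "((\<lambda>x. \<bar>x\<bar> powr a) has_integral (c powr (a + 1) / (a + 1))) {-c..0}"
    using iffD2[OF has_integral_reflect_real[of "\<lambda>x. \<bar>x\<bar> powr a" _ c 0] right]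
    by (simp only: abs_minus_cancel minus_zero)
  show ?thesis
    using has_integral_combine[OF _ _ left right] assms by (simp only: mult_2)
qed

lemma borel_measurable_p_dens [measurable]: "p_dens \<alpha> \<in> borel_measurable borel"
  unfolding p_dens_def[abs_def] by measurable

lemma space_phase_dist [simp]: "space (phase_dist \<alpha>) = UNIV"
  and sets_phase_dist [simp, measurable_cong]: "sets (phase_dist \<alpha>) = sets borel"
  by (simp_all add: phase_dist_def)

text \<open>The normalizing constant cancels the factor from integrating the power. Taking d = pi
  yields total mass 1, and d = pi / (2N) yields the probability of the window.\<close>

lemma emeasure_phase_dist_symmetric:
  assumes "0 < \<alpha>" "\<alpha> < 1" "0 \<le> d" "d \<le> pi"
  shows "emeasure (phase_dist \<alpha>) {-d..d} = ennreal ((d / pi) powr (1 - \<alpha>))"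
proof -
  let ?C = "(1 - \<alpha>) / (2 * pi powr (1 - \<alpha>))"
  have "((\<lambda>x. ?C * \<bar>x\<bar> powr (-\<alpha>)) has_integral (?C * (2 * (d powr (-\<alpha> + 1) / (-\<alpha> + 1))))) {-d..d}"
    using assms by (intro has_integral_mult_right has_integral_abs_powr_symmetric) auto
  also have "?C * (2 * (d powr (-\<alpha> + 1) / (-\<alpha> + 1))) = (d / pi) powr (1 - \<alpha>)"
    using assms by (simp add: powr_divide)
  finally have int: "((\<lambda>x. ?C * \<bar>x\<bar> powr (-\<alpha>)) has_integral (d / pi) powr (1 - \<alpha>)) {-d..d}" .
  have "emeasure (phase_dist \<alpha>) {-d..d} = (\<integral>\<^sup>+x. ennreal (p_dens \<alpha> x) * indicator {-d..d} x \<partial>lborel)"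
    unfolding phase_dist_def by (rule emeasure_density) auto
  \<comment> \<open>The two integrands agree even at x = 0, where \<open>0 powr a = 0\<close> and
    \<open>1 / 0 = 0\<close> make both vanish.\<close>
  also have "\<dots> = (\<integral>\<^sup>+x. ennreal (?C * \<bar>x\<bar> powr (-\<alpha>)) * indicator {-d..d} x \<partial>lborel)"
    using assms by (intro nn_integral_cong) (auto simp: p_dens_def powr_minus_divide split: split_indicator)
  also have "\<dots> = ennreal ((d / pi) powr (1 - \<alpha>))"
    using assms by (intro nn_integral_has_integral_lebesgue' int) auto
  finally show ?thesis .
qed

lemma prob_space_phase_dist:
  assumes "0 < \<alpha>" "\<alpha> < 1"
  shows "prob_space (phase_dist \<alpha>)"
proof
  have "emeasure (phase_dist \<alpha>) UNIV = (\<integral>\<^sup>+x. ennreal (p_dens \<alpha> x) * indicator UNIV x \<partial>lborel)"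
    unfolding phase_dist_def by (rule emeasure_density) auto
  also have "\<dots> = (\<integral>\<^sup>+x. ennreal (p_dens \<alpha> x) * indicator {-pi..pi} x \<partial>lborel)"
    by (intro nn_integral_cong) (simp add: p_dens_def split: split_indicator)
  also have "\<dots> = emeasure (phase_dist \<alpha>) {-pi..pi}"
    unfolding phase_dist_def by (rule emeasure_density[symmetric]) auto
  also have "\<dots> = 1"
    using emeasure_phase_dist_symmetric[of \<alpha> pi] assms by simp
  finally show "emeasure (phase_dist \<alpha>) (space (phase_dist \<alpha>)) = 1" by simp
qed

text \<open>Chernoff bound with parameter 1/4: exp (1/4) \<ge> 5/4 gives 1 - exp (-1/4) \<ge> 1/5, and
  1/5 - 3/16 = 1/80.\<close>

lemma prob_few_hits_le:
  fixes M :: "'a measure" and N :: nat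
  assumes "prob_space M" and A: "A \<in> sets M"
  defines "m \<equiv> real N * measure M A"
  shows "measure (PiM {..<N} (\<lambda>_. M))
     {\<omega> \<in> space (PiM {..<N} (\<lambda>_. M)). real (card {l\<in>{..<N}. \<omega> l \<in> A}) \<le> 3 / 4 * m} \<le> exp (- m / 80)"
proof -
  interpret M: prob_space M by fact
  interpret product_prob_space "\<lambda>_. M" "{..<N}" by standard
  let ?P = "PiM {..<N} (\<lambda>_. M)"
  interpret P: prob_space ?P by (rule prob_space_PiM) (rule assms(1))
  define g :: "'a \<Rightarrow> real" where "g x = exp (- (1/4) * indicator A x)" for x
  define K where "K \<omega> = real (card {l\<in>{..<N}. \<omega> l \<in> A})" for \<omega> :: "nat \<Rightarrow> 'a"
  have [measurable]: "g \<in> borel_measurable M" unfolding g_def using A by measurable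
  have K: "K \<omega> = (\<Sum>l<N. indicator A (\<omega> l))" for \<omega>
    unfolding K_def by (simp add: indicator_def sum.If_cases Int_def)
  \<comment> \<open>The number of hits is a sum over coordinates, so its exponential is a product
    and the expectation factors over the product measure.\<close>
  have expK: "exp (- (1/4) * K \<omega>) = (\<Prod>l<N. g (\<omega> l))" for \<omega>
    unfolding K g_def by (simp only: sum_distrib_left exp_sum[OF finite_lessThan])
  have g_int: "integrable M g"
    by (rule M.integrable_const_bound[of _ 1]) (auto simp: g_def)
  have gP_int: "integrable ?P (\<lambda>\<omega>. \<Prod>l<N. g (\<omega> l))"
    by (rule product_integrable_prod) (auto intro: g_int)
  have Eg: "(\<integral>x. g x \<partial>M) = 1 - (1 - exp (- (1/4))) * measure M A"
  proof -
    have "(\<integral>x. g x \<partial>M) = (\<integral>x. 1 - (1 - exp (- (1/4))) * indicator A x \<partial>M)"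
      by (intro Bochner_Integration.integral_cong) (auto simp: g_def split: split_indicator)
    also have "\<dots> = 1 - (1 - exp (- (1/4))) * measure M A"
    proof -
      have "integrable M (indicator A :: 'a \<Rightarrow> real)"
        using A by (intro M.integrable_const_bound[of _ 1]) auto
      then show ?thesis
        using A by (subst Bochner_Integration.integral_diff) (auto simp: M.prob_space)
    qed
    finally show ?thesis .
  qed
  have e14: "1 - exp (- (1/4 :: real)) \<ge> 1/5"
    using exp_ge_add_one_self[of "1/4 :: real"] by (simp add: exp_minus field_simps)
  have "(\<integral>x. g x \<partial>M) \<le> exp (- (1/5) * measure M A)"
  proof -
    have "(\<integral>x. g x \<partial>M) \<le> 1 + (- (1/5) * measure M A)"
      unfolding Eg using mult_right_mono[OF e14, of "measure M A"] by simp
    also have "\<dots> \<le> exp (- (1/5) * measure M A)" by (rule exp_ge_add_one_self)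
    finally show ?thesis .
  qed
  moreover have "0 \<le> (\<integral>x. g x \<partial>M)" by (rule Bochner_Integration.integral_nonneg) (simp add: g_def)
  ultimately have "(\<integral>x. g x \<partial>M) ^ N \<le> exp (- (1/5) * measure M A) ^ N"
    by (rule power_mono)
  also have "\<dots> = exp (- m / 5)"
    by (simp add: m_def exp_of_nat_mult[symmetric])
  finally have EP: "(\<integral>\<omega>. exp (- (1/4) * K \<omega>) \<partial>?P) \<le> exp (- m / 5)"
    unfolding expK by (subst product_integral_prod) (auto intro: g_int)
  \<comment> \<open>Few hits means that exp (-K/4) is large, which puts the event in the form for
    Markov's inequality.\<close>
  have "measure ?P {\<omega> \<in> space ?P. K \<omega> \<le> 3 / 4 * m}
      = measure ?P {\<omega> \<in> space ?P. exp (- (1/4) * K \<omega>) \<ge> exp (- (3/16) * m)}"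
    by (rule arg_cong[where f = "measure ?P"]) auto
  also have "\<dots> \<le> (\<integral>\<omega>. exp (- (1/4) * K \<omega>) \<partial>?P) / exp (- (3/16) * m)"
    by (rule integral_Markov_inequality_measure[where A = "space ?P"])
       (simp_all only: expK gP_int, auto simp: g_def intro!: prod_nonneg)
  also have "\<dots> \<le> exp (- m / 5) / exp (- (3/16) * m)"
    using EP by (intro divide_right_mono) auto
  also have "\<dots> = exp (- m / 80)"
    by (simp add: exp_diff[symmetric])
  finally show ?thesis unfolding K_def .
qed

section \<open>The largest eigenvalue of the Vandermonde Gram matrix\<close>

text \<open>The form of a Gram matrix v* v at x is the squared norm of v x. This gives its
  nonnegativity and reduces lower bounds to the rows of v.\<close>

lemma quad_form_gram:
  assumes "\<And>i j. i < n \<Longrightarrow> j < n \<Longrightarrow> b i j = (\<Sum>k<m. cnj (v k i) * v k j)"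
  shows "quad_form n b x = (\<Sum>k<m. (cmod (\<Sum>l<n. v k l * x l))\<^sup>2)"
proof -
  have "(\<Sum>i<n. \<Sum>j<n. cnj (x i) * b i j * x j)
      = (\<Sum>i<n. \<Sum>j<n. \<Sum>k<m. cnj (v k i * x i) * (v k j * x j))"
    by (intro sum.cong refl) (simp add: assms sum_distrib_left sum_distrib_right mult_ac)
  also have "\<dots> = (\<Sum>i<n. \<Sum>k<m. \<Sum>j<n. cnj (v k i * x i) * (v k j * x j))"
    by (intro sum.cong refl sum.swap)
  also have "\<dots> = (\<Sum>k<m. \<Sum>i<n. \<Sum>j<n. cnj (v k i * x i) * (v k j * x j))"
    by (rule sum.swap)
  also have "\<dots> = (\<Sum>k<m. cnj (\<Sum>l<n. v k l * x l) * (\<Sum>l<n. v k l * x l))"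
    by (simp only: cnj_sum sum_product)
  also have "\<dots> = complex_of_real (\<Sum>k<m. (cmod (\<Sum>l<n. v k l * x l))\<^sup>2)"
    by (simp only: cnj_mult_self of_real_sum)
  finally show ?thesis unfolding quad_form_def by (simp only: Re_complex_of_real)
qed

lemma VstarV_carrier [simp]: "VstarV N \<theta> \<in> carrier_mat N N"
  unfolding VstarV_def vandermonde_def mat_adjoint_def by (auto simp: mat_of_rows_def)

lemma VstarV_index:
  assumes "i < N" "j < N"
  shows "VstarV N \<theta> $$ (i, j)
    = (\<Sum>k<N. cnj (vandermonde N \<theta> $$ (k, i)) * vandermonde N \<theta> $$ (k, j))"
  using assms
  by (simp add: VstarV_def mat_adjoint_def scalar_prod_def lessThan_atLeast0 vandermonde_def
      mat_of_rows_def)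

lemma VstarV_hermitian:
  assumes "i < N" "j < N"
  shows "VstarV N \<theta> $$ (j, i) = cnj (VstarV N \<theta> $$ (i, j))"
  using assms by (simp add: VstarV_index mult.commute)

lemma quad_form_VstarV:
  "quad_form N (\<lambda>i j. VstarV N \<theta> $$ (i, j)) x
    = (\<Sum>k<N. (cmod (\<Sum>l<N. vandermonde N \<theta> $$ (k, l) * x l))\<^sup>2)"
  by (rule quad_form_gram) (rule VstarV_index)

section \<open>Measurability of the largest eigenvalue as a function of the phases\<close>

lemma less_max_eigenvalue_VstarV_iff:
  assumes "N > 0"
  shows "a < max_eigenvalue (VstarV N \<theta>) \<longleftrightarrow>
    (\<exists>y. a * (\<Sum>i<N. (cmod (y i))\<^sup>2) < quad_form N (\<lambda>i j. VstarV N \<theta> $$ (i, j)) y)"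
    (is "_ \<longleftrightarrow> ?R")
proof
  assume "a < max_eigenvalue (VstarV N \<theta>)"
  moreover obtain x where "(\<Sum>i<N. (cmod (x i))\<^sup>2) = 1"
    "quad_form N (\<lambda>i j. VstarV N \<theta> $$ (i, j)) x = max_eigenvalue (VstarV N \<theta>)"
    using max_eigenvalue_attained[OF VstarV_carrier assms VstarV_hermitian] by blast
  ultimately show ?R by (intro exI[of _ x]) simp
next
  assume ?R
  then obtain y where "a * (\<Sum>i<N. (cmod (y i))\<^sup>2) < quad_form N (\<lambda>i j. VstarV N \<theta> $$ (i, j)) y" ..
  also have "\<dots> \<le> max_eigenvalue (VstarV N \<theta>) * (\<Sum>i<N. (cmod (y i))\<^sup>2)"
    by (rule quad_form_le_max_eigenvalue[OF VstarV_carrier assms VstarV_hermitian])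
  \<comment> \<open>The criterion avoids division by the norm: a vector that is zero on the indices
    below \<open>N\<close> cannot satisfy the strict inequality.\<close>
  finally show "a < max_eigenvalue (VstarV N \<theta>)"
    by (rule mult_right_less_imp_less) (simp add: sum_nonneg)
qed

text \<open>For each fixed y the Rayleigh inequality is an open condition on the phases. The largest
  eigenvalue is therefore lower semicontinuous, hence Borel.\<close>

lemma borel_measurable_max_eigenvalue_VstarV:
  assumes "N > 0"
  shows "(\<lambda>\<theta>. max_eigenvalue (VstarV N \<theta>)) \<in> borel_measurable (PiM {..<N} (\<lambda>_. borel))"
proof -
  have "open {\<theta> :: nat \<Rightarrow> real. a < max_eigenvalue (VstarV N \<theta>)}" for a
  proof -
    have "continuous_on UNIV (\<lambda>\<theta>. vandermonde N \<theta> $$ (k, l))" if "k < N" "l < N" for k l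
      using that by (simp add: vandermonde_def) (intro continuous_intros; simp)
    then have "open {\<theta>. a * (\<Sum>i<N. (cmod (y i))\<^sup>2) < quad_form N (\<lambda>i j. VstarV N \<theta> $$ (i, j)) y}" for y
      unfolding quad_form_VstarV by (intro open_Collect_less continuous_intros) auto
    then show ?thesis
      unfolding less_max_eigenvalue_VstarV_iff[OF assms] by (rule open_Collect_ex)
  qed
  then have F: "(\<lambda>\<theta>. max_eigenvalue (VstarV N \<theta>)) \<in> borel_measurable borel"
    by (auto simp: borel_measurable_iff_greater)
  \<comment> \<open>Elements of the product space are undefined outside the index set, so extend them by 0 to
    use the product topology on all sequences.\<close>
  define h :: "(nat \<Rightarrow> real) \<Rightarrow> nat \<Rightarrow> real" where "h \<theta> i = (if i < N then \<theta> i else 0)" for \<theta> i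
  have "h \<in> borel_measurable (PiM {..<N} (\<lambda>_. borel))"
  proof (rule measurable_coordinatewise_then_product)
    show "(\<lambda>\<theta>. h \<theta> i) \<in> borel_measurable (PiM {..<N} (\<lambda>_. borel))" for i
      by (cases "i < N") (simp_all add: h_def)
  qed
  from measurable_compose[OF this F]
  have "(\<lambda>\<theta>. max_eigenvalue (VstarV N (h \<theta>))) \<in> borel_measurable (PiM {..<N} (\<lambda>_. borel))" .
  moreover have "vandermonde N (h \<theta>) = vandermonde N \<theta>" for \<theta>
    unfolding vandermonde_def h_def by (intro eq_matI) auto
  ultimately show ?thesis by (simp add: VstarV_def)
qed

section \<open>Lower bound on the largest eigenvalue from phases near 0\<close>

lemma cos_ge_one_minus_half_square: "cos x \<ge> 1 - x\<^sup>2 / 2" for x :: real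
proof -
  have "(sin (x / 2))\<^sup>2 \<le> (x / 2)\<^sup>2"
    using abs_sin_x_le_abs_x[of "x / 2"] by (rule iffD1[OF abs_le_square_iff])
  then show ?thesis
    using cos_double_sin[of "x / 2"] by (simp add: power_divide)
qed

lemma sum_centered_squares:
  "(\<Sum>k<N. (real k - (real N - 1) / 2)\<^sup>2) = real N * ((real N)\<^sup>2 - 1) / 12"
proof -
  \<comment> \<open>The centre depends on \<open>N\<close>, so the induction runs with a constant c
    and the centre is substituted afterwards.\<close>
  have "(\<Sum>k<N. (real k - c)\<^sup>2)
      = (real N - 1) * real N * (2 * real N - 1) / 6 - c * (real N * (real N - 1)) + real N * c\<^sup>2" for c
    by (induction N) (auto simp: power2_eq_square field_simps)
  from this[of "(real N - 1) / 2"] show ?thesis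
    by (simp only:) (simp add: power2_eq_square field_simps)
qed

text \<open>The phase factors of \<open>x\<close> replace the frequency k by the centred c k. In
  every row the selected terms then have nearly aligned arguments, so the real part of their sum is
  of order K / sqrt N; summing squares over the N rows gives order K^2, against squared norm
  K.\<close>

lemma max_eigenvalue_VstarV_ge_card:
  fixes N :: nat and \<theta> :: "nat \<Rightarrow> real"
  assumes N: "N > 0"
  defines "S \<equiv> {l\<in>{..<N}. \<theta> l \<in> {- (pi / (2 * real N)) .. pi / (2 * real N)}}"
  shows "2 / 3 * real (card S) \<le> max_eigenvalue (VstarV N \<theta>)"
proof -
  define K where "K = real (card S)"
  define c where "c k = real k - (real N - 1) / 2" for k
  \<comment> \<open>A lower bound for cos (c k * t), uniform over t in the window.\<close>
  define r where "r k = 1 - (c k)\<^sup>2 * (pi / (2 * real N))\<^sup>2 / 2" for k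
  define x where "x l = (if l \<in> S then cis ((real N - 1) / 2 * \<theta> l) else 0)" for l
  have SN: "S \<subseteq> {..<N}" unfolding S_def by auto
  have K0: "K \<ge> 0" unfolding K_def by simp
  have norm_x: "(\<Sum>i<N. (cmod (x i))\<^sup>2) = K"
  proof -
    have "(\<Sum>i<N. (cmod (x i))\<^sup>2) = (\<Sum>i<N. if i \<in> S then 1 else 0)"
      by (intro sum.cong) (auto simp: x_def)
    then show ?thesis
      using SN by (simp add: sum.If_cases K_def Int_absorb1)
  qed
  have row: "(1 / real N) * (K\<^sup>2 * (1 - (c k)\<^sup>2 * (pi / (2 * real N))\<^sup>2))
      \<le> (cmod (\<Sum>l<N. vandermonde N \<theta> $$ (k, l) * x l))\<^sup>2" if k: "k < N" for k
  proof -
    have "(\<Sum>l<N. vandermonde N \<theta> $$ (k, l) * x l)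
        = (\<Sum>l\<in>S. vandermonde N \<theta> $$ (k, l) * x l)"
      using SN by (intro sum.mono_neutral_right) (auto simp: x_def)
    also have "\<dots> = (\<Sum>l\<in>S. complex_of_real (1 / sqrt (real N)) * cis (- (c k * \<theta> l)))"
    proof (intro sum.cong refl)
      fix l assume l: "l \<in> S"
      have "exp (- \<i> * of_nat k * complex_of_real (\<theta> l)) = cis (- (real k * \<theta> l))"
        by (simp add: cis_conv_exp mult.assoc)
      moreover have "cis (- (real k * \<theta> l)) * cis ((real N - 1) / 2 * \<theta> l) = cis (- (c k * \<theta> l))"
        unfolding cis_mult c_def by (simp add: algebra_simps)
      ultimately show "vandermonde N \<theta> $$ (k, l) * x l
          = complex_of_real (1 / sqrt (real N)) * cis (- (c k * \<theta> l))"
        using l SN k by (auto simp: vandermonde_def x_def mult.assoc)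
    qed
    finally have Re: "Re (\<Sum>l<N. vandermonde N \<theta> $$ (k, l) * x l)
        = 1 / sqrt (real N) * (\<Sum>l\<in>S. cos (c k * \<theta> l))"
      by (simp add: sum_distrib_left)
    \<comment> \<open>Centering the frequencies keeps the arguments of the cosines in the range from -pi/4 to pi/4;
      with the uncentered test vector the average of the squared cosines would only tend to 1/2.\<close>
    have "K * r k = (\<Sum>l\<in>S. r k)" by (simp add: K_def)
    also have "\<dots> \<le> (\<Sum>l\<in>S. cos (c k * \<theta> l))"
    proof (rule sum_mono)
      fix l assume "l \<in> S"
      then have "\<bar>\<theta> l\<bar> \<le> pi / (2 * real N)" unfolding S_def by auto
      then have "(\<theta> l)\<^sup>2 \<le> (pi / (2 * real N))\<^sup>2"
        using power_mono[of "\<bar>\<theta> l\<bar>" _ 2] by simp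
      then have "(c k * \<theta> l)\<^sup>2 \<le> (c k)\<^sup>2 * (pi / (2 * real N))\<^sup>2"
        unfolding power_mult_distrib by (intro mult_left_mono) auto
      then show "r k \<le> cos (c k * \<theta> l)"
        using cos_ge_one_minus_half_square[of "c k * \<theta> l"] unfolding r_def by linarith
    qed
    finally have "K * r k \<le> (\<Sum>l\<in>S. cos (c k * \<theta> l))" .
    \<comment> \<open>Squaring the row bound requires a nonnegative left side. Here |c k| is at most
      N / 2, so the cosine arguments are at most pi / 4 < 1 in absolute value.\<close>
    moreover have "0 \<le> r k"
    proof -
      have "\<bar>c k\<bar> \<le> real N / 2" using k unfolding c_def by (auto simp: abs_if field_simps)
      then have "\<bar>c k\<bar> * (pi / (2 * real N)) \<le> real N / 2 * (pi / (2 * real N))"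
        by (intro mult_right_mono) auto
      also have "\<dots> \<le> 1" using N pi_less_4 by simp
      finally have "(\<bar>c k\<bar> * (pi / (2 * real N)))\<^sup>2 \<le> 1"
        by (intro power_le_one) auto
      then show ?thesis unfolding r_def power_mult_distrib power2_abs by linarith
    qed
    ultimately have "(K * r k)\<^sup>2 \<le> (\<Sum>l\<in>S. cos (c k * \<theta> l))\<^sup>2"
      using K0 by (intro power_mono) auto
    then have "(1 / real N) * (K * r k)\<^sup>2 \<le> (1 / real N) * (\<Sum>l\<in>S. cos (c k * \<theta> l))\<^sup>2"
      by (intro mult_left_mono) auto
    also have "\<dots> = (Re (\<Sum>l<N. vandermonde N \<theta> $$ (k, l) * x l))\<^sup>2"
      unfolding Re by (simp add: power_mult_distrib power_divide)
    also have "\<dots> \<le> (cmod (\<Sum>l<N. vandermonde N \<theta> $$ (k, l) * x l))\<^sup>2"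
      using abs_Re_le_cmod by (metis abs_ge_zero power2_abs power_mono)
    finally have "(1 / real N) * (K * r k)\<^sup>2
        \<le> (cmod (\<Sum>l<N. vandermonde N \<theta> $$ (k, l) * x l))\<^sup>2" .
    \<comment> \<open>Bernoulli's inequality leaves a term linear in (c k)^2, so that the sum over k
      needs only the second moment of the centred indices.\<close>
    moreover have "1 - (c k)\<^sup>2 * (pi / (2 * real N))\<^sup>2 \<le> (r k)\<^sup>2"
    proof -
      have "1 - 2 * t \<le> (1 - t)\<^sup>2" for t :: real by (simp add: power2_eq_square algebra_simps)
      from this[of "(c k)\<^sup>2 * (pi / (2 * real N))\<^sup>2 / 2"] show ?thesis unfolding r_def by simp
    qed
    then have "(1 / real N) * (K\<^sup>2 * (1 - (c k)\<^sup>2 * (pi / (2 * real N))\<^sup>2))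
        \<le> (1 / real N) * (K * r k)\<^sup>2"
      unfolding power_mult_distrib[of K] by (intro mult_left_mono) auto
    ultimately show ?thesis by linarith
  qed
  have "2 / 3 * K\<^sup>2 \<le> (1 / real N) * (K\<^sup>2 * (real N - real N * ((real N)\<^sup>2 - 1) / 12 * (pi / (2 * real N))\<^sup>2))"
  proof -
    \<comment> \<open>The average loss over the rows is at most pi^2 / 48; the crude bound pi < 4
      makes this at most 1/3, whence the constant 2/3.\<close>
    have pi2: "pi\<^sup>2 \<le> 16" using power_mono[of pi 4 2] pi_less_4 by simp
    have "pi\<^sup>2 * ((real N)\<^sup>2 - 1) \<le> 16 * (real N)\<^sup>2"
      using pi2 N by (intro mult_mono) auto
    then have "((real N)\<^sup>2 - 1) / 12 * (pi / (2 * real N))\<^sup>2 \<le> 1 / 3"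
      using N by (simp add: power_divide power_mult_distrib divide_le_eq)
    then have "K\<^sup>2 * (2 / 3) \<le> K\<^sup>2 * (1 - ((real N)\<^sup>2 - 1) / 12 * (pi / (2 * real N))\<^sup>2)"
      by (intro mult_left_mono) auto
    also have "\<dots> = (1 / real N) * (K\<^sup>2 * (real N - real N * ((real N)\<^sup>2 - 1) / 12 * (pi / (2 * real N))\<^sup>2))"
      using N by (simp add: field_simps)
    finally show ?thesis by simp
  qed
  also have "\<dots> = (\<Sum>k<N. (1 / real N) * (K\<^sup>2 * (1 - (c k)\<^sup>2 * (pi / (2 * real N))\<^sup>2)))"
    unfolding sum_distrib_left[symmetric] sum_subtractf sum_distrib_right[symmetric]
      c_def sum_centered_squares by simp
  also have "\<dots> \<le> quad_form N (\<lambda>i j. VstarV N \<theta> $$ (i, j)) x"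
    unfolding quad_form_VstarV by (intro sum_mono row) simp
  also have "\<dots> \<le> max_eigenvalue (VstarV N \<theta>) * K"
    unfolding norm_x[symmetric]
    by (rule quad_form_le_max_eigenvalue[OF VstarV_carrier N VstarV_hermitian])
  finally have le: "2 / 3 * K * K \<le> max_eigenvalue (VstarV N \<theta>) * K"
    by (simp add: power2_eq_square)
  show ?thesis
  proof (cases "K = 0")
    \<comment> \<open>With no phase in the window the test vector is 0 and K cannot be cancelled;
      nonnegativity of the Gram form gives the claim instead.\<close>
    case True
    obtain y where y: "quad_form N (\<lambda>i j. VstarV N \<theta> $$ (i, j)) y = max_eigenvalue (VstarV N \<theta>)"
      using max_eigenvalue_attained[OF VstarV_carrier N VstarV_hermitian] by blast
    have "0 \<le> max_eigenvalue (VstarV N \<theta>)"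
      unfolding y[symmetric] quad_form_VstarV by (simp add: sum_nonneg)
    then show ?thesis using True unfolding K_def by simp
  next
    case False
    with K0 le show ?thesis unfolding K_def by simp
  qed
qed

section \<open>The probability estimate and its limit\<close>

theorem theorem8:
  fixes \<alpha> :: real
  assumes "0 < \<alpha>" and "\<alpha> < 1"
  shows "(\<lambda>N. measure (phases_law \<alpha> N)
            {\<theta> \<in> space (phases_law \<alpha> N).
               max_eigenvalue (VstarV N \<theta>) \<ge> 1/2 * (real N powr \<alpha> / 2 powr (1 - \<alpha>))})
         \<longlonglongrightarrow> 1"
proof -
  define m where "m N = real N powr \<alpha> / 2 powr (1 - \<alpha>)" for N
  define E where "E N = {\<theta> \<in> space (phases_law \<alpha> N). max_eigenvalue (VstarV N \<theta>) \<ge> 1/2 * m N}" for N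
  have P: "prob_space (phases_law \<alpha> N)" for N
    unfolding phases_law_def by (intro prob_space_PiM prob_space_phase_dist assms)
  have lower: "1 - exp (- m N / 80) \<le> measure (phases_law \<alpha> N) (E N)" if N: "N > 0" for N
  proof -
    let ?L = "phases_law \<alpha> N"
    interpret prob_space ?L by (rule P)
    let ?A = "{- (pi / (2 * real N)) .. pi / (2 * real N)}"
    let ?K = "\<lambda>\<theta>. real (card {l\<in>{..<N}. \<theta> l \<in> ?A})"
    let ?F = "{\<theta> \<in> space ?L. ?K \<theta> \<le> 3 / 4 * m N}"
    have "measure (phase_dist \<alpha>) ?A = (1 / (2 * real N)) powr (1 - \<alpha>)"
      using emeasure_phase_dist_symmetric[OF assms, of "pi / (2 * real N)"] N
      by (simp add: measure_def divide_le_eq)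
    \<comment> \<open>N (2N)^(\<alpha> - 1) = N^\<alpha> / 2^(1 - \<alpha>), so the threshold of the
      theorem is half the expected number of hits.\<close>
    then have mean: "real N * measure (phase_dist \<alpha>) ?A = m N"
      unfolding m_def using N
      by (simp add: powr_divide powr_mult powr_diff field_simps)
    have "sets ?L = sets (PiM {..<N} (\<lambda>_. borel))"
      unfolding phases_law_def by (intro sets_PiM_cong) auto
    then have [measurable]: "(\<lambda>\<theta>. max_eigenvalue (VstarV N \<theta>)) \<in> borel_measurable ?L"
      using borel_measurable_max_eigenvalue_VstarV[OF N] by (simp cong: measurable_cong_sets)
    have E: "E N \<in> sets ?L" unfolding E_def by measurable
    have "prob (space ?L - E N) \<le> prob ?F"
    proof (rule finite_measure_mono)
      show "space ?L - E N \<subseteq> ?F"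
      proof
        fix \<theta> assume \<theta>: "\<theta> \<in> space ?L - E N"
        \<comment> \<open>Outside \<open>E N\<close> the deterministic bound gives 2K/3 < m/2, that
          is K < 3m/4, which is the cutoff of the Chernoff estimate.\<close>
        then have "2 / 3 * ?K \<theta> < 1/2 * m N"
          using max_eigenvalue_VstarV_ge_card[OF N, of \<theta>] unfolding E_def by auto
        then show "\<theta> \<in> ?F" using \<theta> by auto
      qed
      have [measurable]: "(\<lambda>\<theta>. ?K \<theta>) \<in> borel_measurable ?L"
        unfolding phases_law_def by measurable
      show "?F \<in> sets ?L" by measurable
    qed
    also have "prob ?F \<le> exp (- m N / 80)"
      using prob_few_hits_le[OF prob_space_phase_dist[OF assms], of ?A N] mean
      unfolding phases_law_def by simp
    finally show ?thesis using prob_compl[OF E] by simp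
  qed
  have "(\<lambda>N. measure (phases_law \<alpha> N) (E N)) \<longlonglongrightarrow> 1"
  proof (rule tendsto_sandwich)
    \<comment> \<open>Since \<alpha> > 0, the mean m tends to infinity and the error term
      vanishes.\<close>
    show "(\<lambda>N. 1 - exp (- m N / 80)) \<longlonglongrightarrow> 1"
      unfolding m_def using assms by real_asymp
    show "\<forall>\<^sub>F N in sequentially. 1 - exp (- m N / 80) \<le> measure (phases_law \<alpha> N) (E N)"
      using eventually_gt_at_top[of 0] by eventually_elim (rule lower)
    show "\<forall>\<^sub>F N in sequentially. measure (phases_law \<alpha> N) (E N) \<le> 1"
      using prob_space.prob_le_1[OF P] by simp
  qed simp
  then show ?thesis unfolding E_def m_def .
qed

end
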